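(* Let $G$ be a simple connected undirected graph with $n$ vertices and distance eigenvalues $\rho_1\ge\cdots\ge\rho_n$, and suppose that exactly the first $p$ of these eigenvalues are positive (so $\rho_1,\dots,\rho_p>0\ge\rho_{p+1},\dots,\rho_n$), where $1\le p<n$. Then $$E_D(G)\;\le\;\sqrt{\,n\,S_D(G)-\frac{4n}{S_D(G)}\left(\rho_1^2+\cdots+\rho_p^2-\frac{S_D(G)}{2}\right)^2}.$$
   Context: For a connected graph $G$ with vertices $v_1,\dots,v_n$, the distance matrix $D(G)$ is the $n\times n$ symmetric matrix whose $(i,j)$ entry is the shortest-path distance $d_G(v_i,v_j)$. The distance eigenvalues of $G$ are the eigenvalues $\rho_1\ge\cdots\ge\rho_n$ of $D(G)$, listed with multiplicity. $S_D(G)=\sum_{i=1}^n\rho_i^2=\sum_{i=1}^n\sum_{j=1}^n d_G(v_i,v_j)^2$. The distance energy of $G$ is $E_D(G)=\sum_{i=1}^n|\rho_i|$. *)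

theory Defs
  imports
    "Graph_Theory.Digraph_Component"
    "Graph_Theory.Shortest_Path"
    "Jordan_Normal_Form.Char_Poly"
begin

(* Finite simple undirected graphs are the instances of the locale graph of Graph_Theory:
   finite digraphs without loops or parallel arcs whose arc relation is symmetric, each
   undirected edge being a pair of opposite arcs. *)

(* The arc weight 1 turns the minimal walk cost into the number of edges of a shortest path. *)
definition graph_dist :: "('a, 'b) pre_digraph \<Rightarrow> 'a \<Rightarrow> 'a \<Rightarrow> real" where
  "graph_dist G u v = real_of_ereal (wf_digraph.\<mu> G (\<lambda>_. 1) u v)"

(* The list vs is an enumeration of the vertices of G without repetitions. *)
definition distance_matrix :: "('a, 'b) pre_digraph \<Rightarrow> 'a list \<Rightarrow> real mat" where
  "distance_matrix G vs =
     mat (length vs) (length vs) (\<lambda>(i, j). graph_dist G (vs ! i) (vs ! j))"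

(* The real roots of the characteristic polynomial, with multiplicity, in non-increasing order.
   The distance matrix is real symmetric, so these are all of its eigenvalues. Indices start
   at 0. *)
definition distance_eigenvalues :: "('a, 'b) pre_digraph \<Rightarrow> 'a list \<Rightarrow> real list" where
  "distance_eigenvalues G vs =
     rev (sorted_list_of_multiset (proots (char_poly (distance_matrix G vs))))"

definition S_D :: "('a, 'b) pre_digraph \<Rightarrow> 'a list \<Rightarrow> real" where
  "S_D G vs = (\<Sum>\<rho>\<leftarrow>distance_eigenvalues G vs. \<rho>\<^sup>2)"

definition distance_energy :: "('a, 'b) pre_digraph \<Rightarrow> 'a list \<Rightarrow> real" where
  "distance_energy G vs = (\<Sum>\<rho>\<leftarrow>distance_eigenvalues G vs. \<bar>\<rho>\<bar>)"

end

theory Submission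
  imports
    Defs
    "HOL-Analysis.Convex"
    "Jordan_Normal_Form.Schur_Decomposition"
begin

text \<open>
  The improvement over the bound \<open>sqrt (n * S)\<close>, which Cauchy-Schwarz gives directly, comes from
  the trace. Vertices have distance 0 from themselves, so the distance matrix has trace 0, and
  the eigenvalues sum to 0. Hence the positive eigenvalues have the same sum \<open>a\<close> as the absolute
  values of the others, and the energy is \<open>2 * a\<close>.

  Let \<open>P\<close> be the sum of the squares of the \<open>p\<close> positive eigenvalues, and \<open>N\<close> that of the other
  \<open>n - p\<close>. Cauchy-Schwarz on each part gives \<open>a\<^sup>2 \<le> p * P\<close> and
  \<open>a\<^sup>2 \<le> (n - p) * N\<close>. As \<open>a > 0\<close>, both \<open>P\<close> and \<open>N\<close> are positive, and
  \<open>a\<^sup>2 / P + a\<^sup>2 / N \<le> p + (n - p) = n\<close>, where \<open>p\<close> cancels. With \<open>S = P + N\<close> this says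
  \<open>(2 * a)\<^sup>2 \<le> 4 * n * P * N / S\<close>. Since \<open>4 * P * N = S\<^sup>2 - 4 * (P - S / 2)\<^sup>2\<close>,
  the right-hand side is the radicand of the claim. This is \<open>sum_abs_bound_of_sum_zero\<close>.

  What remains is that the real roots of the characteristic polynomial are \<open>n\<close> in number and
  sum to the trace (\<open>distance_eigenvalues_length_and_sum\<close>). The distance matrix is symmetric,
  because walks can be reversed; so its complex eigenvalues are all real and its
  characteristic polynomial splits over the reals (\<open>char_poly_symmetric_real_mat_splits\<close>). Schur
  triangularization then identifies the sum of the roots with the trace
  (\<open>sum_roots_char_poly_eq_trace\<close>).
\<close>

section \<open>Distances in symmetric digraphs\<close>

text \<open>
  Each arc of a walk is replaced by an arc in the opposite direction, and the order of the arcs is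
  reversed.
\<close>

lemma (in sym_digraph) reversed_awalk_exists:
  assumes "awalk u p v"
  shows "\<exists>q. awalk v q u \<and> length q = length p"
  using assms
proof (induct p arbitrary: u)
  case Nil
  then show ?case by (intro exI[of _ "[]"]) (auto simp: awalk_Nil_iff)
next
  case (Cons e es)
  then have e: "e \<in> arcs G" "tail G e = u" and es: "awalk (head G e) es v"
    by (auto simp: awalk_Cons_iff)
  from Cons.hyps[OF es] obtain q where q: "awalk v q (head G e)" "length q = length es"
    by blast
  from e sym_arcs obtain e' where "e' \<in> arcs G" "tail G e' = head G e" "head G e' = u"
    unfolding symmetric_conv by metis
  then have "awalk (head G e) [e'] u"
    by (auto simp: awalk_Cons_iff awalk_Nil_iff)
  with q show ?case by (intro exI[of _ "q @ [e']"]) (auto intro: awalk_appendI)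
qed

lemma (in wf_digraph) awalk_cost_1: "awalk_cost (\<lambda>_. 1) p = real (length p)"
  by (induct p) simp_all

lemma (in sym_digraph) graph_dist_commute: "graph_dist G u v = graph_dist G v u"
proof -
  have le: "\<mu> (\<lambda>_. 1) y x \<le> \<mu> (\<lambda>_. 1) x y" for x y
    unfolding \<mu>_def awalk_cost_1
  proof (rule INF_mono)
    fix p assume "p \<in> {p. awalk x p y}"
    then obtain q where "awalk y q x" "length q = length p"
      using reversed_awalk_exists by blast
    then show "\<exists>q \<in> {q. awalk y q x}. ereal (real (length q)) \<le> ereal (real (length p))"
      by auto
  qed
  show ?thesis
    unfolding graph_dist_def using le[of u v] le[of v u] by simp
qed

lemma (in wf_digraph) graph_dist_self:
  assumes "u \<in> verts G"
  shows "graph_dist G u u = 0"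
proof -
  have "\<mu> (\<lambda>_. 1) u u = 0"
  proof (rule antisym)
    show "\<mu> (\<lambda>_. 1) u u \<le> 0"
      using min_cost_le_walk_cost[of u "[]" u "\<lambda>_. 1"] assms
      by (simp add: awalk_Nil_iff zero_ereal_def)
    show "0 \<le> \<mu> (\<lambda>_. 1) u u"
      unfolding \<mu>_def awalk_cost_1 by (intro INF_greatest) simp
  qed
  then show ?thesis by (simp add: graph_dist_def)
qed

section \<open>Characteristic polynomials of symmetric real matrices\<close>

lemma trace_mult_commute:
  fixes A B :: "'a :: comm_ring_1 mat"
  assumes "A \<in> carrier_mat n n" and "B \<in> carrier_mat n n"
  shows "(\<Sum>i<n. (A * B) $$ (i, i)) = (\<Sum>i<n. (B * A) $$ (i, i))"
proof -
  have "(\<Sum>i<n. (A * B) $$ (i, i)) = (\<Sum>i<n. \<Sum>j<n. A $$ (i, j) * B $$ (j, i))"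
    using assms by (auto simp: scalar_prod_def atLeast0LessThan intro!: sum.cong)
  also have "\<dots> = (\<Sum>j<n. \<Sum>i<n. B $$ (j, i) * A $$ (i, j))"
    by (subst sum.swap) (simp add: mult.commute)
  also have "\<dots> = (\<Sum>i<n. (B * A) $$ (i, i))"
    using assms by (auto simp: scalar_prod_def atLeast0LessThan intro!: sum.cong)
  finally show ?thesis .
qed

text \<open>
  By Schur triangularization, \<open>A = P * B * Q\<close> with \<open>Q\<close> the inverse of \<open>P\<close>, and the roots are the
  diagonal entries of \<open>B\<close>. Moving \<open>Q\<close> to the front preserves the trace and leaves \<open>B\<close>.
\<close>

lemma sum_roots_char_poly_eq_trace:
  fixes A :: "'a :: conjugatable_ordered_field mat"
  assumes A: "A \<in> carrier_mat n n"
    and split: "char_poly A = (\<Prod>e\<leftarrow>es. [:- e, 1:])"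
  shows "sum_list es = (\<Sum>i<n. A $$ (i, i))"
proof -
  obtain B P Q where "schur_decomposition A es = (B, P, Q)"
    by (metis prod_cases3)
  from schur_decomposition[OF A split this]
  have sim: "similar_mat_wit A B P Q" and diag: "diag_mat B = es" by auto
  note wit = similar_mat_witD2[OF A sim]
  have "(\<Sum>i<n. A $$ (i, i)) = (\<Sum>i<n. ((P * B) * Q) $$ (i, i))"
    using wit by simp
  also have "\<dots> = (\<Sum>i<n. (Q * (P * B)) $$ (i, i))"
    using wit by (intro trace_mult_commute) auto
  also have "Q * (P * B) = B"
    using wit by (metis assoc_mult_mat left_mult_one_mat)
  also have "(\<Sum>i<n. B $$ (i, i)) = sum_list es"
    using wit unfolding diag[symmetric] diag_mat_def
    by (simp add: sum_list_sum_nth atLeast0LessThan)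
  finally show ?thesis by simp
qed

text \<open>
  The classical argument for Hermitian matrices: if \<open>A v = e v\<close>, then moving \<open>A\<close> across the inner
  product \<open>\<langle>A v, v\<rangle>\<close> shows that it equals both \<open>e \<langle>v, v\<rangle>\<close> and
  \<open>cnj e \<langle>v, v\<rangle>\<close>, where \<open>\<langle>v, v\<rangle> \<noteq> 0\<close>.
\<close>

lemma eigenvalue_symmetric_real_mat_is_real:
  fixes A :: "real mat"
  assumes A: "A \<in> carrier_mat n n"
    and sym: "transpose_mat A = A"
    and ev: "eigenvalue (map_mat complex_of_real A) e"
  shows "e \<in> \<real>"
proof -
  let ?C = "map_mat complex_of_real A"
  have C: "?C \<in> carrier_mat n n" using A by simp
  have symC: "transpose_mat ?C = ?C"
    using sym A
    by (metis (no_types, lifting) map_mat_transpose)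
  from ev obtain v where v: "v \<in> carrier_vec n" "v \<noteq> 0\<^sub>v n" and Cv: "?C *\<^sub>v v = e \<cdot>\<^sub>v v"
    using C unfolding eigenvalue_def eigenvector_def by auto
  have conj: "?C *\<^sub>v conjugate v = conjugate (?C *\<^sub>v v)"
    using A v(1)
    by (intro eq_vecI) (auto simp: scalar_prod_def sum_conjugate conjugate_complex_def)
  have "e * (v \<bullet>c v) = (?C *\<^sub>v v) \<bullet>c v"
    using v by (simp add: Cv)
  also have "\<dots> = v \<bullet> (?C *\<^sub>v conjugate v)"
    using transpose_vec_mult_scalar[OF C, of "conjugate v" v] v symC by simp
  also have "\<dots> = cnj e * (v \<bullet>c v)"
    using v by (simp add: conj Cv conjugate_smult_vec)
  finally have "e = cnj e"
    using v by simp
  then show ?thesis by (metis Reals_cnj_iff)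
qed

text \<open>
  Over the complex numbers every polynomial splits. All roots are real here, so the complex
  factorization is the image of a real one, and the embedding of real into complex polynomials
  is injective.
\<close>

lemma char_poly_symmetric_real_mat_splits:
  fixes A :: "real mat"
  assumes A: "A \<in> carrier_mat n n"
    and sym: "transpose_mat A = A"
  shows "\<exists>es. char_poly A = (\<Prod>e\<leftarrow>es. [:- e, 1:]) \<and> length es = n"
proof -
  let ?C = "map_mat complex_of_real A"
  have C: "?C \<in> carrier_mat n n" using A by simp
  interpret poly_hom: map_poly_inj_idom_hom complex_of_real ..
  obtain as where as: "char_poly ?C = (\<Prod>a\<leftarrow>as. [:- a, 1:])" "length as = n"
    using char_poly_factorized[OF C] by blast
  have "a \<in> \<real>" if "a \<in> set as" for a
  proof (rule eigenvalue_symmetric_real_mat_is_real[OF A sym])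
    show "eigenvalue ?C a"
      using that unfolding eigenvalue_root_char_poly[OF C] as
      by (auto simp: poly_prod_list prod_list_zero_iff)
  qed
  then have "map (complex_of_real \<circ> Re) as = as"
    by (intro map_idI) simp
  then have "char_poly ?C = (\<Prod>a\<leftarrow>map (complex_of_real \<circ> Re) as. [:- a, 1:])"
    using as by simp
  also have "\<dots> = map_poly complex_of_real (\<Prod>e\<leftarrow>map Re as. [:- e, 1:])"
    by (simp add: poly_hom.hom_prod_list hom_distribs o_def)
  finally have "map_poly complex_of_real (char_poly A)
      = map_poly complex_of_real (\<Prod>e\<leftarrow>map Re as. [:- e, 1:])"
    by (simp add: of_real_hom.char_poly_hom[OF A])
  then have "char_poly A = (\<Prod>e\<leftarrow>map Re as. [:- e, 1:])"
    by (simp only: poly_hom.eq_iff)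
  with as(2) show ?thesis by (intro exI[of _ "map Re as"]) simp
qed

lemma proots_prod_linear_factors:
  fixes es :: "'a :: idom list"
  shows "proots (\<Prod>e\<leftarrow>es. [:- e, 1:]) = mset es"
  proof (induct es)
  case (Cons a es)
  have "(\<Prod>e\<leftarrow>es. [:- e, 1:]) \<noteq> 0"
    by (auto simp: prod_list_zero_iff)
  with Cons show ?case
    by (simp add: proots_mult del: mult_pCons_left)
qed simp

section \<open>The energy bound\<close>

lemma distance_eigenvalues_length_and_sum:
  assumes "sym_digraph G" and "set vs \<subseteq> verts G"
  shows "length (distance_eigenvalues G vs) = length vs"
    and "sum_list (distance_eigenvalues G vs) = 0"
proof -
  interpret sym_digraph G by fact
  let ?D = "distance_matrix G vs" and ?n = "length vs"
  have D: "?D \<in> carrier_mat ?n ?n" by (simp add: distance_matrix_def)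
  have sym: "transpose_mat ?D = ?D"
    by (rule eq_matI) (auto simp: distance_matrix_def graph_dist_commute)
  obtain es where es: "char_poly ?D = (\<Prod>e\<leftarrow>es. [:- e, 1:])" "length es = ?n"
    using char_poly_symmetric_real_mat_splits[OF D sym] by blast
  have mset: "mset (distance_eigenvalues G vs) = mset es"
    by (simp add: distance_eigenvalues_def es(1) proots_prod_linear_factors)
  then show "length (distance_eigenvalues G vs) = ?n"
    using es(2) by (metis size_mset)
  have "sum_list (distance_eigenvalues G vs) = sum_list es"
    using mset by (metis sum_mset_sum_list)
  also have "\<dots> = (\<Sum>i<?n. ?D $$ (i, i))"
    by (rule sum_roots_char_poly_eq_trace[OF D es(1)])
  also have "\<dots> = 0"
    using assms(2) by (auto simp: distance_matrix_def intro!: sum.neutral graph_dist_self)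
  finally show "sum_list (distance_eigenvalues G vs) = 0" .
qed

text \<open>
  The analytic core, for arbitrary reals: given their sum of squares, a list with sum 0 has small
  \<open>l\<^sub>1\<close>-norm if the squares are divided unevenly between its positive and nonpositive
  entries, because both kinds contribute the same amount to this norm.
\<close>

lemma sum_abs_bound_of_sum_zero:
  fixes x :: "nat \<Rightarrow> real"
  assumes "1 \<le> p" "p < n"
    and pos: "\<And>i. i < p \<Longrightarrow> x i > 0"
    and nonpos: "\<And>i. p \<le> i \<Longrightarrow> i < n \<Longrightarrow> x i \<le> 0"
    and zero: "(\<Sum>i<n. x i) = 0"
  defines "S \<equiv> \<Sum>i<n. (x i)\<^sup>2"
  shows "(\<Sum>i<n. \<bar>x i\<bar>) \<le> sqrt (n * S - 4 * n / S * ((\<Sum>i<p. (x i)\<^sup>2) - S / 2)\<^sup>2)"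
proof -
  define P N a where "P = (\<Sum>i<p. (x i)\<^sup>2)" and "N = (\<Sum>i=p..<n. (x i)\<^sup>2)"
    and "a = (\<Sum>i<p. x i)"
  have split: "(\<Sum>i<n. f i) = (\<Sum>i<p. f i) + (\<Sum>i=p..<n. f i)" for f :: "nat \<Rightarrow> real"
    using \<open>p < n\<close> sum.atLeastLessThan_concat[of 0 p n f] by (simp add: atLeast0LessThan)
  have neg_a: "(\<Sum>i=p..<n. x i) = - a"
    using zero split[of x] by (simp add: a_def)
  have S: "S = P + N" by (simp add: S_def P_def N_def split)
  have energy: "(\<Sum>i<n. \<bar>x i\<bar>) = 2 * a"
  proof -
    have "(\<Sum>i<p. \<bar>x i\<bar>) = a"
      unfolding a_def using pos by (intro sum.cong) (auto simp: less_imp_le)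
    moreover have "(\<Sum>i=p..<n. \<bar>x i\<bar>) = (\<Sum>i=p..<n. - x i)"
      using nonpos by (intro sum.cong) auto
    ultimately show ?thesis by (simp add: split sum_negf neg_a)
  qed
  have "a > 0"
    unfolding a_def using pos \<open>1 \<le> p\<close> by (intro sum_pos) (auto simp: lessThan_empty_iff)
  have aP: "a\<^sup>2 \<le> p * P"
    using sum_squared_le_sum_of_squares[of x "{..<p}"] by (simp add: a_def P_def mult.commute)
  have aN: "a\<^sup>2 \<le> (real n - p) * N"
    using sum_squared_le_sum_of_squares[of x "{p..<n}"] \<open>p < n\<close>
    by (simp add: neg_a N_def mult.commute of_nat_diff)
  from \<open>a > 0\<close> have "0 < a\<^sup>2" by simp
  with aP aN have "0 < p * P" "0 < (real n - p) * N" by linarith+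
  then have "P > 0" "N > 0"
    using \<open>1 \<le> p\<close> \<open>p < n\<close> by (simp_all add: zero_less_mult_iff)
  \<comment> \<open>\<open>a\<^sup>2 / P + a\<^sup>2 / N \<le> n\<close>, multiplied by \<open>P * N\<close>.\<close>
  have "a\<^sup>2 * S = a\<^sup>2 * N + a\<^sup>2 * P"
    by (simp add: S algebra_simps)
  also have "\<dots> \<le> (p * P) * N + ((real n - p) * N) * P"
    using aP aN \<open>P > 0\<close> \<open>N > 0\<close> by (intro add_mono mult_right_mono) auto
  also have "\<dots> = n * (P * N)"
    by (simp add: algebra_simps)
  finally have "a\<^sup>2 * S \<le> n * (P * N)" .
  moreover have "S > 0" using S \<open>P > 0\<close> \<open>N > 0\<close> by simp
  ultimately have "(2 * a)\<^sup>2 \<le> 4 * real n * (P * N) / S"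
    by (simp add: field_simps)
  also have "\<dots> = n * S - 4 * real n / S * (P - S / 2)\<^sup>2"
    using \<open>S > 0\<close> by (simp add: S field_simps power2_eq_square)
  finally show ?thesis
    unfolding energy P_def by (rule real_le_rsqrt)
qed

theorem proposition3p2:
  fixes G :: "('a, 'b) pre_digraph" and vs :: "'a list" and n p :: nat and \<rho> :: "nat \<Rightarrow> real"
  assumes "graph G" and "Digraph_Component.connected G"
    and "distinct vs" and "set vs = verts G" and "n = length vs"
    and "\<And>i. \<rho> i = distance_eigenvalues G vs ! i"
    and "1 \<le> p" and "p < n"
    and "\<And>i. i < p \<Longrightarrow> \<rho> i > 0"
    and "\<And>i. p \<le> i \<Longrightarrow> i < n \<Longrightarrow> \<rho> i \<le> 0"
  shows "distance_energy G vs \<le>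
    sqrt (real n * S_D G vs
          - 4 * real n / S_D G vs * ((\<Sum>i<p. (\<rho> i)\<^sup>2) - S_D G vs / 2)\<^sup>2)"
proof -
  interpret graph G by fact
  let ?es = "distance_eigenvalues G vs"
  have len: "length ?es = n" and trace: "sum_list ?es = 0"
    using distance_eigenvalues_length_and_sum[OF sym_digraph_axioms, of vs] assms(4,5) by auto
  have sum: "(\<Sum>e\<leftarrow>?es. f e) = (\<Sum>i<n. f (\<rho> i))" for f :: "real \<Rightarrow> real"
    by (simp add: sum_list_sum_nth len assms(6) atLeast0LessThan)
  have "(\<Sum>i<n. \<rho> i) = 0"
    using sum[of "\<lambda>e. e"] trace by simp
  from sum_abs_bound_of_sum_zero[OF assms(7-10) this] show ?thesis
    by (simp add: distance_energy_def S_D_def sum)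
qed

end
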